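(* Let $\mathcal B$ be a basis of a real Banach space $\mathbb X$ and let $w$ be a weight. If $\mathcal B$ is $w$-semi-greedy, then $\mathcal B$ has the $w$-Property (A).
   Context: Basis: a Schauder basis $\mathcal B=(e_n)_{n=1}^\infty$ of a real Banach space $\mathbb X$ with biorthogonal functionals $(e_n^* )_{n=1}^\infty$ such that $0<\inf_n\min\{\|e_n\|,\|e_n^*\|\}\le\sup_n\max\{\|e_n\|,\|e_n^*\|\}<\infty$. For $x\in\mathbb X$, $\mathrm{supp}(x)=\{i\in\mathbb N: e_i^*(x)\neq0\}$. $\mathbb N^{<\infty}$ is the family of finite subsets of $\mathbb N$. For signs $\varepsilon=(\varepsilon_n)$, $\varepsilon_n\in\{\pm1\}$, and finite $A$, $\mathbf 1_{\varepsilon A}=\sum_{n\in A}\varepsilon_ne_n$. A weight is a sequence $w=(w_i)_{i=1}^\infty\in(0,\infty)^{\mathbb N}$; $w(A)=\sum_{i\in A}w_i$. A greedy set of $x$ of cardinality $m\in\mathbb N$ is a set $A_m(x)\subset\mathrm{supp}(x)$ with $|A_m(x)|=m$ and $\min_{k\in A_m(x)}|e_k^*(x)|\ge\sup_{k\notin A_m(x)}|e_k^*(x)|$. A Chebyshev greedy approximand of order $m$ is any $\overline G_m(x)\in\mathrm{span}\{e_i: i\in A_m(x)\}$ with $\|x-\overline G_m(x)\|=\min\{\|x-\sum_{n\in A_m(x)}b_ne_n\|: b_n\in\mathbb R\}$. Inequalities involving these objects are required for every choice of greedy set. $\mathcal B$ is $w$-semi-greedy if there is $C\ge1$ such that $\|x-\overline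 G_m(x)\|\le C\,\sigma^w_{w(A_m(x))}(x)$ for all $x\in\mathbb X$, $m\in\mathbb N$, where $\sigma^w_\delta(x)=\inf\{\|x-\sum_{n\in A}a_ne_n\|: A\in\mathbb N^{<\infty},\ w(A)\le\delta,\ a_n\in\mathbb R\}$. $\mathcal B$ has the $w$-Property (A) if there is $C\ge1$ such that $\|x+t\mathbf 1_{\varepsilon A}\|\le C\|x+t\mathbf 1_{\eta B}\|$ for all $x\in\mathbb X$, all $A,B\in\mathbb N^{<\infty}$ with $w(A)\le w(B)$, $A\cap B=\emptyset$, $\mathrm{supp}(x)\cap(A\cup B)=\emptyset$, all signs $\varepsilon,\eta$, and all $t\ge\sup_j|e_j^*(x)|$. *)

theory Defs
  imports "HOL-Analysis.Analysis"
begin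

text \<open>Bases, weights and signs are indexed from 0.  The dual of a real Banach space \<open>'a\<close> is the
  normed space \<open>'a \<Rightarrow>\<^sub>L real\<close> of bounded linear functionals.\<close>

definition schauder_basis :: "(nat \<Rightarrow> 'a::banach) \<Rightarrow> bool" where
  "schauder_basis e \<longleftrightarrow> (\<forall>x. \<exists>!a::nat \<Rightarrow> real. (\<lambda>n. a n *\<^sub>R e n) sums x)"

definition biorthogonal :: "(nat \<Rightarrow> 'a::banach) \<Rightarrow> (nat \<Rightarrow> 'a \<Rightarrow>\<^sub>L real) \<Rightarrow> bool" where
  "biorthogonal e e' \<longleftrightarrow> (\<forall>i j. blinfun_apply (e' i) (e j) = (if i = j then 1 else 0))"

text \<open>The functionals \<open>e'\<close> are determined by \<open>e\<close>, since the span of a Schauder basis is dense.\<close>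

definition is_basis :: "(nat \<Rightarrow> 'a::banach) \<Rightarrow> (nat \<Rightarrow> 'a \<Rightarrow>\<^sub>L real) \<Rightarrow> bool" where
  "is_basis e e' \<longleftrightarrow> schauder_basis e \<and> biorthogonal e e'
     \<and> 0 < (INF n. min (norm (e n)) (norm (e' n)))
     \<and> bdd_above (range (\<lambda>n. max (norm (e n)) (norm (e' n))))"

definition supp :: "(nat \<Rightarrow> 'a::banach \<Rightarrow>\<^sub>L real) \<Rightarrow> 'a \<Rightarrow> nat set" where
  "supp e' x = {i. blinfun_apply (e' i) x \<noteq> 0}"

definition is_sign :: "(nat \<Rightarrow> real) \<Rightarrow> bool" where
  "is_sign \<epsilon> \<longleftrightarrow> (\<forall>n. \<epsilon> n \<in> {1, -1})"

definition signed_indicator :: "(nat \<Rightarrow> 'a::banach) \<Rightarrow> (nat \<Rightarrow> real) \<Rightarrow> nat set \<Rightarrow> 'a" where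
  "signed_indicator e \<epsilon> A = (\<Sum>n\<in>A. \<epsilon> n *\<^sub>R e n)"

definition is_weight :: "(nat \<Rightarrow> real) \<Rightarrow> bool" where
  "is_weight w \<longleftrightarrow> (\<forall>i. 0 < w i)"

text \<open>The order \<open>m\<close> is positive, so the minimum is over a nonempty finite set.  The supremum is over
  a nonempty set and is finite whenever \<open>is_basis e e'\<close> holds.\<close>

definition is_greedy_set ::
    "(nat \<Rightarrow> 'a::banach \<Rightarrow>\<^sub>L real) \<Rightarrow> 'a \<Rightarrow> nat \<Rightarrow> nat set \<Rightarrow> bool" where
  "is_greedy_set e' x m A \<longleftrightarrow> 1 \<le> m \<and> finite A \<and> A \<subseteq> supp e' x \<and> card A = m
     \<and> Min ((\<lambda>k. \<bar>blinfun_apply (e' k) x\<bar>) ` A) \<ge> (SUP k\<in>-A. \<bar>blinfun_apply (e' k) x\<bar>)"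

definition is_chebyshev_approximand :: "(nat \<Rightarrow> 'a::banach) \<Rightarrow> 'a \<Rightarrow> nat set \<Rightarrow> 'a \<Rightarrow> bool" where
  "is_chebyshev_approximand e x A g \<longleftrightarrow> g \<in> span (e ` A)
     \<and> (\<forall>b::nat \<Rightarrow> real. norm (x - g) \<le> norm (x - (\<Sum>n\<in>A. b n *\<^sub>R e n)))"

definition weighted_error :: "(nat \<Rightarrow> 'a::banach) \<Rightarrow> (nat \<Rightarrow> real) \<Rightarrow> real \<Rightarrow> 'a \<Rightarrow> real" where
  "weighted_error e w \<delta> x =
     Inf {norm (x - (\<Sum>n\<in>A. a n *\<^sub>R e n)) | (A::nat set) (a::nat \<Rightarrow> real). finite A \<and> sum w A \<le> \<delta>}"

definition w_semi_greedy ::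
    "(nat \<Rightarrow> 'a::banach) \<Rightarrow> (nat \<Rightarrow> 'a \<Rightarrow>\<^sub>L real) \<Rightarrow> (nat \<Rightarrow> real) \<Rightarrow> bool" where
  "w_semi_greedy e e' w \<longleftrightarrow> (\<exists>C\<ge>1. \<forall>x m A g.
     is_greedy_set e' x m A \<longrightarrow> is_chebyshev_approximand e x A g \<longrightarrow>
       norm (x - g) \<le> C * weighted_error e w (sum w A) x)"

definition w_property_A ::
    "(nat \<Rightarrow> 'a::banach) \<Rightarrow> (nat \<Rightarrow> 'a \<Rightarrow>\<^sub>L real) \<Rightarrow> (nat \<Rightarrow> real) \<Rightarrow> bool" where
  "w_property_A e e' w \<longleftrightarrow> (\<exists>C\<ge>1. \<forall>x A B \<epsilon> \<eta> t.
     finite A \<longrightarrow> finite B \<longrightarrow> sum w A \<le> sum w B \<longrightarrow> A \<inter> B = {} \<longrightarrow>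
     supp e' x \<inter> (A \<union> B) = {} \<longrightarrow> is_sign \<epsilon> \<longrightarrow> is_sign \<eta> \<longrightarrow>
     t \<ge> (SUP j. \<bar>blinfun_apply (e' j) x\<bar>) \<longrightarrow>
       norm (x + t *\<^sub>R signed_indicator e \<epsilon> A) \<le> C * norm (x + t *\<^sub>R signed_indicator e \<eta> B))"

end

theory Submission
  imports Defs
begin

text \<open>
  Write \<open>f = x + t \<eta>1\<^sub>B\<close> and \<open>u = x + t \<epsilon>1\<^sub>A\<close>. The task is to bound \<open>\<parallel>u\<parallel>\<close> by a multiple of \<open>\<parallel>f\<parallel>\<close>,
  with \<open>w(A) \<le> w(B)\<close> and all coefficients of \<open>x\<close> bounded by \<open>t\<close>. Partial sums of \<open>x\<close> satisfy the same
  hypotheses and converge to \<open>x\<close>, so \<open>x\<close> may be taken finitely supported; the cases \<open>t = 0\<close> and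
  \<open>B = {}\<close> are trivial. A set \<open>D\<close> far to the right
  of all supports then serves as an auxiliary greedy set: the initial projections, whose norms are at
  most the basis constant \<open>K\<close>, remove \<open>D\<close> again.

  If \<open>w(D) \<ge> w(A \<union> B)\<close>, then \<open>D\<close> is a greedy set of \<open>u + t 1\<^sub>D\<close>, and exchanging \<open>\<epsilon>1\<^sub>A\<close> for \<open>\<eta>1\<^sub>B\<close> is an
  admissible competitor. Hence \<open>\<parallel>u\<parallel> \<le> K C \<parallel>f + t 1\<^sub>D\<parallel>\<close> (lemma \<open>exchange_bound\<close>). It remains to bound
  \<open>\<parallel>t 1\<^sub>D\<parallel>\<close> by \<open>\<parallel>f\<parallel>\<close>. If instead \<open>w(D) \<le> w(B)\<close>, then \<open>B\<close> is a greedy set of \<open>f + t 1\<^sub>D\<close>, the vector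
  \<open>f\<close> is an admissible competitor, and projecting onto the tail gives \<open>\<parallel>t 1\<^sub>D\<parallel> \<le> (1 + K) C \<parallel>f\<parallel>\<close> (lemma
  \<open>tail_bound\<close>). The two weight conditions conflict, but when \<open>\<Sum>w\<close> diverges they can be reconciled:
  a shortest far block of weight at least \<open>w(B)\<close> exceeds \<open>w(B)\<close> only through its last index, whose
  vector \<open>t e\<^sub>k\<close> is bounded by a multiple of any coefficient of \<open>f\<close> on \<open>B\<close>. Two such consecutive
  blocks have weight at least \<open>2 w(B) \<ge> w(A \<union> B)\<close>.

  When \<open>\<Sum>w\<close> converges, some tail of \<open>\<nat>\<close> weighs less than \<open>w\<^sub>0\<close>, and \<open>tail_bound\<close> with greedy set
  \<open>{0}\<close> shows that every finitely supported vector with coefficients at most \<open>t\<close> has norm at most a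
  constant times \<open>t\<close>. Since \<open>t\<close> is itself at most a constant times \<open>\<parallel>f\<parallel>\<close>, the bound follows
  (lemma \<open>flat_bound_summable\<close>).
\<close>

section \<open>Uniform boundedness\<close>

text \<open>By Baire's theorem, one of the closed sets on which all \<open>T n\<close> are bounded by \<open>k\<close> contains a
  ball; the difference of two points of the ball reaches every direction.\<close>

lemma uniform_boundedness:
  fixes T :: "nat \<Rightarrow> 'a::banach \<Rightarrow> 'b::real_normed_vector"
  assumes lin: "\<And>n. bounded_linear (T n)"
    and bdd: "\<And>x. \<exists>c. \<forall>n. norm (T n x) \<le> c"
  obtains K where "1 \<le> K" "\<And>n x. norm (T n x) \<le> K * norm x"
proof -
  define F where "F k = (\<Inter>n. {x. norm (T n x) \<le> real k})" for k
  have cont: "continuous_on UNIV (T n)" for n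
    using lin by (simp add: linear_continuous_on)
  have closed: "closed (F k)" for k
    unfolding F_def by (intro closed_INT ballI closed_Collect_le continuous_intros cont)
  have cover: "(\<Union>k. F k) = UNIV"
  proof -
    have "\<exists>k. x \<in> F k" for x
    proof -
      obtain c where c: "\<And>n. norm (T n x) \<le> c" using bdd by blast
      obtain k where "c \<le> real k" using real_arch_simple by blast
      then show ?thesis using c unfolding F_def by (blast intro: order_trans)
    qed
    then show ?thesis by blast
  qed
  have "\<exists>k. interior (F k) \<noteq> {}"
  proof (rule ccontr)
    assume "\<nexists>k. interior (F k) \<noteq> {}"
    then have "euclidean interior_of \<Union>(range F) = {}"
      by (intro Baire_category_alt) (auto simp: closed completely_metrizable_space_euclidean)
    then show False using cover by simp
  qed
  then obtain k a where "a \<in> interior (F k)" by blast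
  then obtain r where r: "r > 0" "cball a r \<subseteq> F k"
    by (meson interior_subset open_contains_cball open_interior order_trans)
  have ball: "norm (T n y) \<le> real k" if "norm (y - a) \<le> r" for n y
    using that r unfolding F_def by (force simp: dist_norm norm_minus_commute)
  define K where "K = max 1 (2 * real k / r)"
  have "norm (T n x) \<le> K * norm x" for n x
  proof (cases "x = 0")
    case True
    then show ?thesis using linear_0[OF bounded_linear.linear[OF lin]] by simp
  next
    case False
    define s where "s = r / norm x"
    have s: "s > 0" using r False by (simp add: s_def)
    interpret T: bounded_linear "T n" by (rule lin)
    have "norm (T n (a + s *\<^sub>R x)) \<le> real k" "norm (T n a) \<le> real k"
      using ball[of "a + s *\<^sub>R x" n] ball[of a n] r False by (simp_all add: s_def)
    moreover have "s *\<^sub>R T n x = T n (a + s *\<^sub>R x) - T n a"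
      by (simp add: T.add T.scaleR)
    ultimately have "norm (s *\<^sub>R T n x) \<le> 2 * real k"
      using norm_triangle_ineq4[of "T n (a + s *\<^sub>R x)" "T n a"] by simp
    then have "s * norm (T n x) \<le> 2 * real k" using s by simp
    then have "norm (T n x) \<le> 2 * real k / r * norm x"
      using s r False by (simp add: s_def field_simps)
    also have "\<dots> \<le> K * norm x" by (intro mult_right_mono) (simp_all add: K_def)
    finally show ?thesis .
  qed
  then show ?thesis using that[of K] by (simp add: K_def)
qed

section \<open>Partial sums of a basis expansion\<close>

definition partial_sum ::
    "(nat \<Rightarrow> 'a::banach) \<Rightarrow> (nat \<Rightarrow> 'a \<Rightarrow>\<^sub>L real) \<Rightarrow> nat \<Rightarrow> 'a \<Rightarrow> 'a" where
  "partial_sum e e' N y = (\<Sum>n<N. blinfun_apply (e' n) y *\<^sub>R e n)"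

lemma bounded_linear_partial_sum: "bounded_linear (partial_sum e e' N)"
  unfolding partial_sum_def
  by (intro bounded_linear_sum bounded_linear_scaleR_const blinfun.bounded_linear_right)

text \<open>Applying the functional \<open>e' j\<close> to the expansion of \<open>x\<close> identifies its \<open>j\<close>-th coefficient.\<close>

lemma partial_sum_tendsto:
  assumes "is_basis e e'"
  shows "(\<lambda>N. partial_sum e e' N x) \<longlonglongrightarrow> x"
proof -
  have bi: "blinfun_apply (e' i) (e j) = (if i = j then 1 else 0)" for i j
    using assms by (simp add: is_basis_def biorthogonal_def)
  obtain a where a: "(\<lambda>n. a n *\<^sub>R e n) sums x"
    using assms unfolding is_basis_def schauder_basis_def by metis
  have "a j = blinfun_apply (e' j) x" for j
  proof -
    have "(\<lambda>n. blinfun_apply (e' j) (a n *\<^sub>R e n)) sums blinfun_apply (e' j) x"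
      using bounded_linear.sums[OF blinfun.bounded_linear_right a] .
    moreover have "(\<lambda>n. blinfun_apply (e' j) (a n *\<^sub>R e n)) = (\<lambda>n. if n = j then a n else 0)"
      by (auto simp: blinfun.scaleR_right bi)
    ultimately show ?thesis using sums_single[of j a] sums_unique2 by metis
  qed
  then show ?thesis using a by (simp add: sums_def partial_sum_def)
qed

lemma basis_constant:
  assumes "is_basis e e'"
  obtains K where "1 \<le> K" "\<And>N y. norm (partial_sum e e' N y) \<le> K * norm y"
proof -
  have "\<exists>c. \<forall>N. norm (partial_sum e e' N y) \<le> c" for y
    using convergent_imp_Bseq[OF convergentI[OF partial_sum_tendsto[OF assms, of y]]]
    by (auto simp: Bseq_def)
  then show ?thesis
    using uniform_boundedness[of "partial_sum e e'"] bounded_linear_partial_sum that by metis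
qed

section \<open>Chebyshev approximation on greedy sets\<close>

text \<open>The quantitative content of the hypotheses: \<open>M\<close> bounds the basis and its functionals, \<open>K\<close>
  bounds the partial sum projections, and \<open>C\<close> is a semi-greedy constant.\<close>

locale semi_greedy_basis =
  fixes e :: "nat \<Rightarrow> 'a::banach" and e' :: "nat \<Rightarrow> 'a \<Rightarrow>\<^sub>L real" and w :: "nat \<Rightarrow> real"
    and M K C :: real
  assumes biorth: "blinfun_apply (e' i) (e j) = (if i = j then 1 else 0)"
    and norm_e: "norm (e n) \<le> M"
    and norm_e': "norm (e' n) \<le> M"
    and M_ge_1: "1 \<le> M"
    and K_ge_1: "1 \<le> K"
    and norm_partial_sum: "norm (partial_sum e e' N y) \<le> K * norm y"
    and w_pos: "0 < w n"
    and C_ge_1: "1 \<le> C"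
    and semi_greedy: "is_greedy_set e' y m G \<Longrightarrow> is_chebyshev_approximand e y G g \<Longrightarrow>
          norm (y - g) \<le> C * weighted_error e w (sum w G) y"
begin

abbreviation combo :: "(nat \<Rightarrow> real) \<Rightarrow> nat set \<Rightarrow> 'a" where
  "combo a A \<equiv> (\<Sum>n\<in>A. a n *\<^sub>R e n)"

abbreviation coeff :: "nat \<Rightarrow> 'a \<Rightarrow> real" where
  "coeff n y \<equiv> blinfun_apply (e' n) y"

abbreviation P :: "nat \<Rightarrow> 'a \<Rightarrow> 'a" where
  "P \<equiv> partial_sum e e'"

lemma P_add: "P N (y + z) = P N y + P N z"
  and P_diff: "P N (y - z) = P N y - P N z"
  by (simp_all add: partial_sum_def blinfun.bilinear_simps algebra_simps sum.distrib sum_subtractf)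

lemma coeff_combo: "finite A \<Longrightarrow> coeff j (combo a A) = (if j \<in> A then a j else 0)"
  by (simp add: blinfun.sum_right blinfun.scaleR_right biorth if_distrib[of "\<lambda>z. _ * z"] cong: if_cong)

lemma abs_coeff_le: "\<bar>coeff n y\<bar> \<le> M * norm y"
  using norm_blinfun[of "e' n" y] mult_right_mono[OF norm_e'[of n], of "norm y"] by simp

lemma P_eq_combo: "P N y = combo (\<lambda>n. coeff n y) {..<N}"
  by (simp add: partial_sum_def)

lemma coeff_P: "coeff j (P N y) = (if j < N then coeff j y else 0)"
  by (simp add: P_eq_combo coeff_combo)

lemma P_P: "P N (P N y) = P N y"
  unfolding P_eq_combo[of N "P N y"] by (simp add: coeff_P) (simp add: P_eq_combo)

lemma P_combo_below:
  assumes "finite A" "A \<subseteq> {..<N}"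
  shows "P N (combo a A) = combo a A"
proof -
  have "P N (combo a A) = (\<Sum>n<N. (if n \<in> A then a n *\<^sub>R e n else 0))"
    unfolding P_eq_combo by (rule sum.cong) (auto simp: coeff_combo[OF assms(1)])
  also have "\<dots> = (\<Sum>n\<in>{..<N} \<inter> A. a n *\<^sub>R e n)" by (simp add: sum.inter_restrict)
  finally show ?thesis using assms(2) by (simp add: Int_absorb1)
qed

lemma P_combo_above:
  assumes "finite D" "D \<subseteq> {N..}"
  shows "P N (combo a D) = 0"
  unfolding P_eq_combo using assms by (intro sum.neutral) (force simp: coeff_combo)

lemma coeff_above:
  assumes "P N y = y" "N \<le> n"
  shows "coeff n y = 0"
  using coeff_P[of n N y] assms by simp

lemma norm_combo_le_card:
  assumes "finite A" "0 \<le> t" "\<And>n. n \<in> A \<Longrightarrow> \<bar>a n\<bar> \<le> t"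
  shows "norm (combo a A) \<le> real (card A) * (t * M)"
proof -
  have "norm (combo a A) \<le> (\<Sum>n\<in>A. norm (a n *\<^sub>R e n))" by (rule norm_sum)
  also have "\<dots> \<le> (\<Sum>n\<in>A. t * M)"
    using assms norm_e by (intro sum_mono) (auto intro!: mult_mono)
  finally show ?thesis by simp
qed

text \<open>Semi-greediness only speaks about minimizers, so one has to exist. Coefficient vectors with a
  large entry give an approximation error above \<open>\<parallel>z\<parallel>\<close> and lose against \<open>0\<close>; the remaining ones
  form a compact box in the product topology.\<close>

lemma best_approximation_exists:
  assumes A: "finite A"
  shows "\<exists>b. \<forall>c. norm (z - combo b A) \<le> norm (z - combo c A)"
proof -
  define R where "R = 2 * (M * norm z)"
  have R: "R \<ge> 0" using M_ge_1 by (simp add: R_def)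
  define S where "S = (PiE UNIV (\<lambda>_. {-R..R}) :: (nat \<Rightarrow> real) set)"
  have "compactin (product_topology (\<lambda>_. euclidean) UNIV) S"
    unfolding S_def using compactin_PiE[THEN iffD2, OF disjI2, of UNIV "\<lambda>_. euclidean" "\<lambda>_. {-R..R}"]
    by (simp add: compactin_euclidean_iff)
  then have S: "compact S" by (simp add: euclidean_product_topology)
  have zero: "(\<lambda>_. 0) \<in> S" using R by (auto simp: S_def)
  have "continuous_on S (\<lambda>b. norm (z - combo b A))"
    by (intro continuous_intros continuous_on_product_then_coordinatewise continuous_on_id)
  then obtain b where b: "b \<in> S" "\<And>c. c \<in> S \<Longrightarrow> norm (z - combo b A) \<le> norm (z - combo c A)"
    using continuous_attains_inf[OF S, of "\<lambda>b. norm (z - combo b A)"] zero by auto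
  have "norm (z - combo b A) \<le> norm (z - combo c A)" for c
  proof (cases "\<forall>n\<in>A. \<bar>c n\<bar> \<le> R")
    case True
    define c' where "c' n = (if n \<in> A then c n else 0)" for n
    have "c' \<in> S" using True R by (auto simp: S_def c'_def abs_le_iff minus_le_iff)
    moreover have "combo c' A = combo c A" by (simp add: c'_def)
    ultimately show ?thesis using b(2) by metis
  next
    case False
    then obtain n where n: "n \<in> A" "R < \<bar>c n\<bar>" by force
    then have "M * (2 * norm z) < M * norm (combo c A)"
      using abs_coeff_le[of n "combo c A"] by (simp add: coeff_combo A R_def)
    then have "2 * norm z < norm (combo c A)" using M_ge_1 by simp
    then have "norm z \<le> norm (z - combo c A)"
      using norm_triangle_ineq2[of "combo c A" z] by (simp add: norm_minus_commute)
    then show ?thesis using b(2)[OF zero] by simp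
  qed
  then show ?thesis by blast
qed

text \<open>The form in which semi-greediness is used: a set carrying the coefficients of modulus at least
  \<open>t\<close> competes, after optimizing its coefficients, with every set of no larger weight.\<close>

lemma greedy_approximation:
  assumes t: "0 < t" and G: "finite G" "G \<noteq> {}"
    and large: "\<And>n. n \<in> G \<Longrightarrow> t \<le> \<bar>coeff n z\<bar>"
    and small: "\<And>n. n \<notin> G \<Longrightarrow> \<bar>coeff n z\<bar> \<le> t"
    and E: "finite E" "sum w E \<le> sum w G"
  obtains b where "norm (z - combo b G) \<le> C * norm (z - combo a E)"
proof -
  obtain b where b: "\<And>c. norm (z - combo b G) \<le> norm (z - combo c G)"
    using best_approximation_exists[OF G(1)] by metis
  have "- G \<noteq> {}" using G(1) by (metis Compl_empty_eq double_compl infinite_UNIV_nat)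
  then have "(SUP k\<in>-G. \<bar>coeff k z\<bar>) \<le> t"
    using small by (intro cSUP_least) auto
  also have "t \<le> Min ((\<lambda>k. \<bar>coeff k z\<bar>) ` G)"
    using G large by simp
  finally have "(SUP k\<in>-G. \<bar>coeff k z\<bar>) \<le> Min ((\<lambda>k. \<bar>coeff k z\<bar>) ` G)" .
  moreover have "G \<subseteq> supp e' z" using large t by (force simp: supp_def)
  ultimately have "is_greedy_set e' z (card G) G"
    using G by (simp del: Min_ge_iff add: is_greedy_set_def card_gt_0_iff Suc_le_eq)
  moreover have "is_chebyshev_approximand e z G (combo b G)"
    unfolding is_chebyshev_approximand_def
    using b by (auto intro!: span_sum span_scale intro: span_base)
  ultimately have "norm (z - combo b G) \<le> C * weighted_error e w (sum w G) z"
    by (rule semi_greedy)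
  moreover have "weighted_error e w (sum w G) z \<le> norm (z - combo a E)"
    unfolding weighted_error_def using E by (intro cInf_lower bdd_belowI[of _ 0]) auto
  ultimately show ?thesis
    using that[of b] C_ge_1 by (smt (verit) mult_left_mono)
qed

section \<open>Vectors supported far to the right\<close>

text \<open>\<open>B\<close> is a greedy set of \<open>f + \<Sum>\<^sub>D a\<^sub>n e\<^sub>n\<close>, while removing the \<open>D\<close>-part is admissible and leaves
  \<open>f\<close>. Changing coefficients on \<open>B\<close> does not touch the tail, so the tail projection recovers the
  \<open>D\<close>-part from the Chebyshev remainder.\<close>

lemma tail_bound:
  assumes t: "0 < t" and B: "finite B" "B \<noteq> {}"
    and f: "P N f = f"
    and large: "\<And>n. n \<in> B \<Longrightarrow> t \<le> \<bar>coeff n f\<bar>"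
    and small: "\<And>n. n \<notin> B \<Longrightarrow> \<bar>coeff n f\<bar> \<le> t"
    and D: "finite D" "D \<subseteq> {N..}" "sum w D \<le> sum w B"
    and a: "\<And>n. n \<in> D \<Longrightarrow> \<bar>a n\<bar> \<le> t"
  shows "norm (combo a D) \<le> (1 + K) * C * norm f"
proof -
  define z where "z = f + combo a D"
  have BN: "B \<subseteq> {..<N}"
    using large t coeff_above[OF f] by (force simp: not_less[symmetric])
  have coeff_z: "coeff n z = coeff n f + (if n \<in> D then a n else 0)" for n
    by (simp add: z_def blinfun.add_right coeff_combo D)
  have coeff_D: "coeff n f = 0" if "n \<in> D" for n
    using that D(2) coeff_above[OF f] by auto
  have "t \<le> \<bar>coeff n z\<bar>" if "n \<in> B" for n
    using that subsetD[OF BN, of n] subsetD[OF D(2), of n] large[of n] by (auto simp: coeff_z)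
  moreover have "\<bar>coeff n z\<bar> \<le> t" if "n \<notin> B" for n
    using that small a coeff_D by (auto simp: coeff_z)
  ultimately obtain b where "norm (z - combo b B) \<le> C * norm (z - combo a D)"
    using greedy_approximation[OF t B _ _ D(1,3), of z] by blast
  define v where "v = z - combo b B"
  have v: "norm v \<le> C * norm f"
    using \<open>norm (z - combo b B) \<le> _\<close> by (simp add: z_def v_def)
  have "P N v = f - combo b B"
    using P_combo_below[OF B(1) BN] P_combo_above[OF D(1,2)] f
    by (simp add: v_def z_def P_add P_diff)
  then have "combo a D = v - P N v" by (simp add: v_def z_def)
  then have "norm (combo a D) \<le> norm v + K * norm v"
    using norm_triangle_ineq4[of v "P N v"] norm_partial_sum[of N v] by simp
  also have "\<dots> = (1 + K) * norm v" by (simp add: algebra_simps)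
  also have "\<dots> \<le> (1 + K) * (C * norm f)" using v K_ge_1 by (intro mult_left_mono) auto
  finally show ?thesis by simp
qed

text \<open>Here \<open>D\<close> is the greedy set, of \<open>u + t 1\<^sub>D\<close>, and the competitor alters \<open>u\<close> on \<open>E\<close>. Changing
  coefficients on \<open>D\<close> does not touch the initial segment, so the initial projection recovers \<open>u\<close>
  from the Chebyshev remainder.\<close>

lemma exchange_bound:
  assumes t: "0 < t" and u: "P N u = u" "\<And>n. \<bar>coeff n u\<bar> \<le> t"
    and D: "finite D" "D \<noteq> {}" "D \<subseteq> {N..}"
    and E: "finite E" "sum w E \<le> sum w D"
  shows "norm u \<le> K * C * norm (u - combo a E + combo (\<lambda>_. t) D)"
proof -
  define z where "z = u + combo (\<lambda>_. t) D"
  have coeff_z: "coeff n z = (if n \<in> D then t else coeff n u)" for n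
    using coeff_above[OF u(1), of n] subsetD[OF D(3), of n]
    by (auto simp: z_def blinfun.add_right coeff_combo D)
  obtain b where b: "norm (z - combo b D) \<le> C * norm (z - combo a E)"
    using greedy_approximation[OF t D(1,2) _ _ E, of z] t u(2) by (auto simp: coeff_z)
  have "P N (z - combo b D) = u"
    using P_combo_above[OF D(1,3)] u(1) by (simp add: z_def P_add P_diff)
  then have "norm u \<le> K * norm (z - combo b D)"
    using norm_partial_sum by metis
  also have "\<dots> \<le> K * (C * norm (z - combo a E))"
    using b K_ge_1 by (intro mult_left_mono) auto
  finally show ?thesis by (simp add: z_def algebra_simps)
qed

lemma minimal_block:
  assumes "\<not> summable w" "0 < s"
  obtains k where "N \<le> k" "sum w {N..<k} < s" "s \<le> sum w {N..<Suc k}"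
proof -
  have "\<exists>k. s \<le> sum w {N..<k}"
  proof (rule ccontr)
    assume "\<nexists>k. s \<le> sum w {N..<k}"
    then have less: "sum w {N..<k} < s" for k by (simp add: not_le)
    have "sum w {..k} \<le> sum w {..<N} + s" for k
    proof -
      have "sum w {..k} \<le> sum w ({..<N} \<union> {N..<Suc k})"
        using w_pos by (intro sum_mono2) (auto intro: less_imp_le)
      also have "\<dots> = sum w {..<N} + sum w {N..<Suc k}"
        by (rule sum.union_disjoint) auto
      finally show ?thesis using less[of "Suc k"] by simp
    qed
    then have "summable w"
      using w_pos by (intro bounded_imp_summable) (auto intro: less_imp_le)
    then show False using assms by simp
  qed
  define k where "k = (LEAST k. s \<le> sum w {N..<k})"
  have k: "s \<le> sum w {N..<k}"
    unfolding k_def using LeastI_ex[OF \<open>\<exists>k. _\<close>] .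
  have "N < k" using k assms(2) by (cases "N < k") auto
  then obtain j where j: "k = Suc j" "N \<le> j" by (cases k) auto
  have "sum w {N..<j} < s"
    using not_less_Least[of j "\<lambda>k. s \<le> sum w {N..<k}"] j(1) by (simp add: k_def[symmetric])
  then show ?thesis using that j k by auto
qed

text \<open>A shortest block reaching weight \<open>w(B)\<close> satisfies the hypothesis of \<open>tail_bound\<close> once its last
  index \<open>k\<close> is removed, and \<open>t e\<^sub>k\<close> is controlled because \<open>t\<close> is at most the modulus of a
  coefficient of \<open>f\<close>.\<close>

lemma flat_block:
  assumes "\<not> summable w" and t: "0 < t" and B: "finite B" "B \<noteq> {}"
    and f: "P N f = f"
    and large: "\<And>n. n \<in> B \<Longrightarrow> t \<le> \<bar>coeff n f\<bar>"
    and small: "\<And>n. n \<notin> B \<Longrightarrow> \<bar>coeff n f\<bar> \<le> t"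
    and L: "N \<le> L"
  obtains k where "L \<le> k" "sum w B \<le> sum w {L..<k}"
    "norm (combo (\<lambda>_. t) {L..<k}) \<le> ((1 + K) * C + M * M) * norm f"
proof -
  have "0 < sum w B" using B w_pos by (intro sum_pos) auto
  then obtain k where k: "L \<le> k" "sum w {L..<k} < sum w B" "sum w B \<le> sum w {L..<Suc k}"
    using minimal_block[OF assms(1)] by metis
  have "norm (combo (\<lambda>_. t) {L..<k}) \<le> (1 + K) * C * norm f"
    using k L t by (intro tail_bound[OF t B f large small]) auto
  moreover have "norm (t *\<^sub>R e k) \<le> M * M * norm f"
  proof -
    obtain n where "n \<in> B" using B by blast
    then have "t \<le> M * norm f" using large abs_coeff_le[of n f] by force
    then have "t * norm (e k) \<le> (M * norm f) * M"
      using t norm_e[of k] M_ge_1 by (intro mult_mono) auto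
    then show ?thesis using t by (simp add: mult_ac)
  qed
  moreover have "combo (\<lambda>_. t) {L..<Suc k} = combo (\<lambda>_. t) {L..<k} + t *\<^sub>R e k"
    using k(1) by simp
  ultimately have "norm (combo (\<lambda>_. t) {L..<Suc k}) \<le> ((1 + K) * C + M * M) * norm f"
    using norm_triangle_ineq[of "combo (\<lambda>_. t) {L..<k}" "t *\<^sub>R e k"]
    by (simp add: distrib_right)
  then show ?thesis using that[of "Suc k"] k by simp
qed

section \<open>Comparison of finitely supported vectors\<close>

text \<open>Two consecutive blocks are used because exchanging \<open>A\<close> for \<open>B\<close> costs weight
  \<open>w(A) + w(B)\<close>, up to twice \<open>w(B)\<close>.\<close>

lemma property_A_nonsummable:
  assumes ns: "\<not> summable w" and t: "0 < t" and A: "finite A" and B: "finite B" "B \<noteq> {}"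
    and wAB: "sum w A \<le> sum w B" and disj: "A \<inter> B = {}"
    and u: "P N u = u" "\<And>n. \<bar>coeff n u\<bar> \<le> t"
    and f: "P N f = f" "\<And>n. n \<in> B \<Longrightarrow> \<bar>coeff n f\<bar> = t" "\<And>n. \<bar>coeff n f\<bar> \<le> t"
    and diff: "u - f = combo a (A \<union> B)"
  shows "norm u \<le> K * C * (1 + 2 * ((1 + K) * C + M * M)) * norm f"
proof -
  let ?c = "((1 + K) * C + M * M) * norm f"
  let ?I = "combo (\<lambda>_. t)"
  have large: "t \<le> \<bar>coeff n f\<bar>" if "n \<in> B" for n using f(2)[OF that] by simp
  have "0 < sum w B" using B w_pos by (intro sum_pos) auto
  obtain k where k: "N \<le> k" "sum w B \<le> sum w {N..<k}" "norm (?I {N..<k}) \<le> ?c"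
    by (rule flat_block[OF ns t B f(1), of N]) (use large f(3) in auto)
  obtain l where l: "k \<le> l" "sum w B \<le> sum w {k..<l}" "norm (?I {k..<l}) \<le> ?c"
    by (rule flat_block[OF ns t B f(1), of k]) (use large f(3) k(1) in auto)
  have w_split: "sum w {N..<l} = sum w {N..<k} + sum w {k..<l}"
    using k l by (simp add: sum.atLeastLessThan_concat)
  have I_split: "?I {N..<l} = ?I {N..<k} + ?I {k..<l}"
    using k l by (simp add: sum.atLeastLessThan_concat)
  have "sum w (A \<union> B) \<le> sum w {N..<l}"
    using k l wAB by (simp add: w_split sum.union_disjoint[OF A B(1) disj])
  moreover have "{N..<l} \<noteq> {}" using \<open>0 < sum w B\<close> k l w_split
    by (metis add_pos_pos less_le_trans order_less_irrefl sum.empty)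
  ultimately have "norm u \<le> K * C * norm (u - combo a (A \<union> B) + ?I {N..<l})"
    using A B by (intro exchange_bound[OF t u]) auto
  also have "u - combo a (A \<union> B) = f" using diff by (simp add: algebra_simps)
  also have "K * C * norm (f + ?I {N..<l}) \<le> K * C * (norm f + (?c + ?c))"
    using K_ge_1 C_ge_1 k l norm_triangle_ineq[of f "?I {N..<l}"]
      norm_triangle_ineq[of "?I {N..<k}" "?I {k..<l}"]
    by (intro mult_left_mono) (simp_all only: I_split, auto)
  finally show ?thesis by (simp add: algebra_simps)
qed

text \<open>From some index \<open>L'\<close> on, the whole tail weighs less than \<open>w 0\<close>, so \<open>{0}\<close> is heavy enough to act
  as the set \<open>B\<close> of \<open>tail_bound\<close> for every tail vector. Below \<open>L'\<close> the triangle inequality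
  suffices.\<close>

lemma flat_bound_summable:
  assumes "summable w"
  obtains c where "1 \<le> c"
    "\<And>N t u. 0 < t \<Longrightarrow> P N u = u \<Longrightarrow> (\<And>n. \<bar>coeff n u\<bar> \<le> t) \<Longrightarrow> norm u \<le> c * t"
proof -
  obtain L where L: "\<And>k. \<bar>sum w {L..<k}\<bar> < w 0"
    using assms w_pos[of 0] unfolding summable_Cauchy by (metis order_refl real_norm_def)
  (* L' > 0 ensures that the index 0 lies below the tail. *)
  define L' where "L' = Suc L"
  define c where "c = L' * M + (1 + K) * C * M"
  have "norm u \<le> c * t" if t: "0 < t" and u: "P N u = u" "\<And>n. \<bar>coeff n u\<bar> \<le> t" for N t u
  proof -
    let ?a = "\<lambda>n. coeff n u"
    have head: "norm (combo ?a {..<L'}) \<le> L' * (t * M)"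
      using norm_combo_le_card[of "{..<L'}" t ?a] t u by simp
    have tail: "norm (combo ?a {L'..<N}) \<le> (1 + K) * C * (t * M)"
    proof -
      let ?f = "t *\<^sub>R e 0"
      have f: "P L' ?f = ?f"
        using P_combo_below[of "{0}" L' "\<lambda>_. t"] by (simp add: L'_def)
      have w0: "sum w {L'..<N} \<le> sum w {0}"
      proof -
        have "sum w {L'..<N} \<le> sum w {L..<N}"
          using w_pos by (intro sum_mono2) (auto simp: L'_def intro: less_imp_le)
        then show ?thesis using L[of N] by simp
      qed
      have "norm (combo ?a {L'..<N}) \<le> (1 + K) * C * norm ?f"
        using t u w0 by (intro tail_bound[OF t _ _ f, of "{0}"]) (auto simp: blinfun.scaleR_right biorth)
      also have "\<dots> \<le> (1 + K) * C * (t * M)"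
        using t norm_e[of 0] K_ge_1 C_ge_1 by (intro mult_left_mono) auto
      finally show ?thesis .
    qed
    have "u = combo ?a {..<max N L'}"
    proof -
      have "combo ?a {..<max N L'} = combo ?a {..<N}"
        using coeff_above[OF u(1)] by (intro sum.mono_neutral_right) auto
      then show ?thesis using u(1) by (simp add: P_eq_combo)
    qed
    also have "{..<max N L'} = {..<L'} \<union> {L'..<N}" by auto
    also have "combo ?a \<dots> = combo ?a {..<L'} + combo ?a {L'..<N}"
      by (rule sum.union_disjoint) auto
    finally have "norm u \<le> L' * (t * M) + (1 + K) * C * (t * M)"
      using head tail norm_triangle_ineq[of "combo ?a {..<L'}" "combo ?a {L'..<N}"] by simp
    then show ?thesis by (simp add: c_def algebra_simps)
  qed
  moreover have "1 \<le> c"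
  proof -
    have "1 * 1 \<le> L' * M" using M_ge_1 by (intro mult_mono) (auto simp: L'_def)
    moreover have "0 \<le> (1 + K) * C * M" using M_ge_1 K_ge_1 C_ge_1 by simp
    ultimately show ?thesis by (simp add: c_def)
  qed
  ultimately show ?thesis using that by blast
qed

lemma property_A_finite_support:
  obtains c where "1 \<le> c"
    "\<And>t A B N u f a. \<lbrakk>0 < t; finite A; finite B; B \<noteq> {}; sum w A \<le> sum w B; A \<inter> B = {};
      P N u = u; \<And>n. \<bar>coeff n u\<bar> \<le> t; P N f = f; \<And>n. n \<in> B \<Longrightarrow> \<bar>coeff n f\<bar> = t;
      \<And>n. \<bar>coeff n f\<bar> \<le> t; u - f = combo a (A \<union> B)\<rbrakk> \<Longrightarrow> norm u \<le> c * norm f"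
proof (cases "summable w")
  case True
  obtain c where c: "1 \<le> c"
    "\<And>N t u. 0 < t \<Longrightarrow> P N u = u \<Longrightarrow> (\<And>n. \<bar>coeff n u\<bar> \<le> t) \<Longrightarrow> norm u \<le> c * t"
    using flat_bound_summable[OF True] by metis
  have "norm u \<le> (c * M) * norm f"
    if "0 < t" "B \<noteq> {}" "P N u = u" "\<And>n. \<bar>coeff n u\<bar> \<le> t" "\<And>n. n \<in> B \<Longrightarrow> \<bar>coeff n f\<bar> = t"
    for t N u f and B :: "nat set"
  proof -
    obtain n where "n \<in> B" using \<open>B \<noteq> {}\<close> by blast
    then have "t \<le> M * norm f" using that(5) abs_coeff_le[of n f] by metis
    then have "c * t \<le> c * (M * norm f)" using c(1) by (intro mult_left_mono) auto
    then show ?thesis using c(2)[OF that(1,3,4)] by simp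
  qed
  moreover have "1 * 1 \<le> c * M" using c M_ge_1 by (intro mult_mono) auto
  ultimately show ?thesis using that[of "c * M"] by simp
next
  case False
  let ?c = "K * C * (1 + 2 * ((1 + K) * C + M * M))"
  have "1 * 1 * 1 \<le> ?c"
    using K_ge_1 C_ge_1 M_ge_1 by (intro mult_mono) auto
  then show ?thesis
    using that[of ?c] property_A_nonsummable[OF False] by simp
qed

end

theorem theorem3p7:
  fixes e :: "nat \<Rightarrow> 'a::banach" and e' :: "nat \<Rightarrow> 'a \<Rightarrow>\<^sub>L real" and w :: "nat \<Rightarrow> real"
  assumes "is_basis e e'"
    and "is_weight w"
    and "w_semi_greedy e e' w"
  shows "w_property_A e e' w"
proof -
  obtain K where K: "1 \<le> K" "\<And>N y. norm (partial_sum e e' N y) \<le> K * norm y"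
    using basis_constant[OF assms(1)] by metis
  obtain M0 where M0: "\<And>n. max (norm (e n)) (norm (e' n)) \<le> M0"
    using assms(1) unfolding is_basis_def bdd_above_def by blast
  obtain C where C: "1 \<le> C" "\<And>x m A g. is_greedy_set e' x m A \<Longrightarrow>
      is_chebyshev_approximand e x A g \<Longrightarrow> norm (x - g) \<le> C * weighted_error e w (sum w A) x"
    using assms(3) unfolding w_semi_greedy_def by blast
  interpret semi_greedy_basis e e' w "max 1 M0" K C
  proof
    show "norm (e n) \<le> max 1 M0" "norm (e' n) \<le> max 1 M0" for n
      using M0[of n] by auto
  qed (use assms K C in \<open>auto simp: is_basis_def biorthogonal_def is_weight_def\<close>)
  obtain c where c: "1 \<le> c"
    "\<And>t A B N u f a. \<lbrakk>0 < t; finite A; finite B; B \<noteq> {}; sum w A \<le> sum w B; A \<inter> B = {};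
      P N u = u; \<And>n. \<bar>coeff n u\<bar> \<le> t; P N f = f; \<And>n. n \<in> B \<Longrightarrow> \<bar>coeff n f\<bar> = t;
      \<And>n. \<bar>coeff n f\<bar> \<le> t; u - f = combo a (A \<union> B)\<rbrakk> \<Longrightarrow> norm u \<le> c * norm f"
    using property_A_finite_support by blast
  have "norm (x + t *\<^sub>R signed_indicator e \<epsilon> A) \<le> c * norm (x + t *\<^sub>R signed_indicator e \<eta> B)"
    if A: "finite A" and B: "finite B" and wAB: "sum w A \<le> sum w B" and disj: "A \<inter> B = {}"
      and x: "supp e' x \<inter> (A \<union> B) = {}" and sg: "is_sign \<epsilon>" "is_sign \<eta>"
      and t: "(SUP j. \<bar>coeff j x\<bar>) \<le> t" for x A B \<epsilon> \<eta> t
  proof -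
    have bdd: "bdd_above (range (\<lambda>j. \<bar>coeff j x\<bar>))"
      using abs_coeff_le by (intro bdd_aboveI) blast
    have x_le: "\<bar>coeff j x\<bar> \<le> t" for j
      using cSUP_upper[OF _ bdd, of j] t by simp
    have x_zero: "coeff j x = 0" if "j \<in> A \<union> B" for j
      using x that by (auto simp: supp_def)
    have abs_sg: "\<bar>\<epsilon> n\<bar> = 1" "\<bar>\<eta> n\<bar> = 1" for n
      using sg by (auto simp: is_sign_def dest: spec[of _ n])
    define p q where "p = t *\<^sub>R signed_indicator e \<epsilon> A" and "q = t *\<^sub>R signed_indicator e \<eta> B"
    have p: "p = combo (\<lambda>n. t * \<epsilon> n) A" and q: "q = combo (\<lambda>n. t * \<eta> n) B"
      by (simp_all add: p_def q_def signed_indicator_def scaleR_sum_right)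
    have lim: "(\<lambda>N. P N x) \<longlonglongrightarrow> x" by (rule partial_sum_tendsto[OF assms(1)])
    obtain N0 where N0: "A \<union> B \<subseteq> {..<N0}"
      using A B finite_nat_bounded[of "A \<union> B"] by auto
    \<comment> \<open>Truncation beyond \<open>A \<union> B\<close> only shortens \<open>x\<close>, so the finitely supported case applies to \<open>P N x\<close>.\<close>
    have "norm (P N x + p) \<le> c * norm (P N x + q)" if "N0 \<le> N" for N
    proof -
      consider "B = {}" | "t = 0" | "B \<noteq> {}" "0 < t"
        using x_le[of 0] by fastforce
      then show ?thesis
      proof cases
        case 1
        have "A = {}"
        proof (rule ccontr)
          assume "A \<noteq> {}"
          then have "0 < sum w A" using A w_pos by (intro sum_pos) auto
          then show False using wAB 1 by simp
        qed
        then show ?thesis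
          using 1 c(1) mult_right_mono[of 1 c "norm (P N x)"] by (simp add: p q)
      next
        case 2
        then have "P N x = 0" using x_le by (simp add: P_eq_combo)
        then show ?thesis using 2 c(1) by (simp add: p q)
      next
        case 3
        have AN: "A \<subseteq> {..<N}" and BN: "B \<subseteq> {..<N}" using N0 that by auto
        define a where "a n = (if n \<in> A then t * \<epsilon> n else - (t * \<eta> n))" for n
        have "combo a (A \<union> B) = combo a A + combo a B"
          using sum.union_disjoint[OF A B disj] .
        also have "combo a A = p" by (simp add: p a_def)
        also have "combo a B = - q"
          using disj by (auto simp: q a_def sum_negf[symmetric] intro!: sum.cong)
        finally have diff: "(P N x + p) - (P N x + q) = combo a (A \<union> B)" by simp
        show ?thesis
        proof (rule c(2)[OF 3(2) A B 3(1) wAB disj _ _ _ _ _ diff])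
          show "P N (P N x + p) = P N x + p" "P N (P N x + q) = P N x + q"
            using P_combo_below[OF A AN] P_combo_below[OF B BN] by (simp_all add: P_add P_P p q)
          show "\<bar>coeff n (P N x + p)\<bar> \<le> t" "\<bar>coeff n (P N x + q)\<bar> \<le> t" for n
            using x_zero[of n] x_le[of n] 3(2)
            by (auto simp: p q blinfun.add_right coeff_P coeff_combo A B abs_mult abs_sg)
          show "\<bar>coeff n (P N x + q)\<bar> = t" if "n \<in> B" for n
            using that x_zero[of n] 3(2)
            by (auto simp: q blinfun.add_right coeff_P coeff_combo B abs_mult abs_sg)
        qed
      qed
    qed
    then have "\<forall>N\<ge>N0. norm (P N x + p) \<le> c * norm (P N x + q)" by blast
    then have "norm (x + p) \<le> c * norm (x + q)"
      by (intro LIMSEQ_le[of "\<lambda>N. norm (P N x + p)" _ "\<lambda>N. c * norm (P N x + q)"]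
          tendsto_intros lim) blast
    then show ?thesis by (simp add: p_def q_def)
  qed
  then show ?thesis unfolding w_property_A_def using c(1) by blast
qed

end
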